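(* Let $p\in(0,1)\setminus\{\tfrac12\}$, let $n\in\mathbb{N}$, and let $\mathcal{A}=\{S\subset[n] : 1\notin S\}$. Let $\lambda\in[0,1]$ be such that $\mu_p^{(\mathbb{N})}(\mathcal{L}_\lambda)=1-p\ (=\mu_p^{(n)}(\mathcal{A}))$. Then $$I^p[\mathcal{A}] = 1 < I^p[\mathcal{L}_\lambda].$$
   Context: $[n]=\{1,\dots,n\}$, $\mathbb{N}=\{1,2,\dots\}$, and $\mathcal{P}(X)$ is the power set of $X$. The $p$-biased measure on $\mathcal{P}([n])$ is $\mu_p^{(n)}(\{S\}) = p^{|S|}(1-p)^{n-|S|}$. $\Sigma$ is the $\sigma$-algebra on $\mathcal{P}(\mathbb{N})\cong\{0,1\}^{\mathbb{N}}$ generated by the families depending on only finitely many coordinates, and $\mu_p^{(\mathbb{N})}$ is the $p$-biased product measure on $(\mathcal{P}(\mathbb{N}),\Sigma)$ (each $j\in\mathbb{N}$ is included in the random set independently with probability $p$). Influences: for $\mathcal{F}\subset\mathcal{P}([n])$ and $i\in[n]$, $I_i^p[\mathcal{F}] := \Pr_{S\sim\mu_p^{(n)}}[\,|\mathcal{F}\cap\{S,S\Delta\{i\}\}|=1\,]$ and $I^p[\mathcal{F}]:=\sum_{i=1}^n I_i^p[\mathcal{F}]$. For $\mathcal{F}\in\Sigma$ and $i\in\mathbb{N}$, $I_i^p[\mathcal{F}] := \Pr_{S\sim\mu_p^{(\mathbb{N})}}[\,|\mathcal{F}\cap\{S,S\Delta\{i\}\}|=1\,]$ and $I^p[\mathcal{F}]:=\sum_{i=1}^\infty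 I_i^p[\mathcal{F}]$. Lexicographic families $\mathcal{L}_\lambda\subset\mathcal{P}(\mathbb{N})$: $\mathcal{L}_0=\emptyset$, $\mathcal{L}_1=\mathcal{P}(\mathbb{N})$. For $\lambda\in(0,1)$, let $\lambda=\sum_j 2^{-i_j}$ with $1\le i_1<i_2<\cdots$ be its binary expansion (the finite one if $\lambda$ is a dyadic rational), and define $\mathcal{L}_\lambda := \bigcup_j\{S\subset\mathbb{N} : S\cap[i_j] = [i_j]\setminus\{i_k : k<j\}\}$. (This is the initial segment, with $\mu_{1/2}^{(\mathbb{N})}$-measure $\lambda$, of the lexicographic ordering on $\mathcal{P}(\mathbb{N})$ given by $S>T$ iff $\min(S\Delta T)\in S$, initial segments consisting of the largest elements.) *)

theory Defs
  imports "HOL-Probability.Probability"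
begin

text \<open>
  Here \<open>[n]\<close> is \<^term>\<open>{1..n::nat}\<close> and the positive integers are \<^term>\<open>{1::nat..}\<close>, so that
  families of sets are of type \<^typ>\<open>nat set set\<close>, contained in \<^term>\<open>Pow {1..n::nat}\<close> or in
  \<^term>\<open>Pow {1::nat..}\<close>.
\<close>

subsection \<open>The biased measures\<close>

definition biased_measure :: "real \<Rightarrow> nat \<Rightarrow> nat set measure" where
  "biased_measure p n =
     point_measure (Pow {1..n}) (\<lambda>S. ennreal (p ^ card S * (1 - p) ^ (n - card S)))"

definition cylinder_families :: "nat set set set" where
  "cylinder_families =
     {\<F>. \<F> \<subseteq> Pow {1..} \<and>
          (\<exists>J. finite J \<and> (\<forall>S\<in>Pow {1..}. \<forall>T\<in>Pow {1..}. S \<inter> J = T \<inter> J \<longrightarrow> (S \<in> \<F> \<longleftrightarrow> T \<in> \<F>)))}"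

text \<open>
  The product measure lives on Boolean sequences; it is transported along the identification of
  sequences with subsets, onto the sigma-algebra generated by the cylinder families.
\<close>

definition biased_measure_inf :: "real \<Rightarrow> nat set measure" where
  "biased_measure_inf p =
     distr (\<Pi>\<^sub>M i\<in>{1..}. measure_pmf (bernoulli_pmf p))
           (sigma (Pow {1..}) cylinder_families)
           (\<lambda>\<omega>. {i\<in>{1..}. \<omega> i})"

subsection \<open>Influences\<close>

definition influence :: "real \<Rightarrow> nat \<Rightarrow> nat set set \<Rightarrow> nat \<Rightarrow> real" where
  "influence p n \<F> i =
     measure (biased_measure p n) {S \<in> Pow {1..n}. card (\<F> \<inter> {S, sym_diff S {i}}) = 1}"

definition total_influence :: "real \<Rightarrow> nat \<Rightarrow> nat set set \<Rightarrow> real" where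
  "total_influence p n \<F> = (\<Sum>i=1..n. influence p n \<F> i)"

definition influence_inf :: "real \<Rightarrow> nat set set \<Rightarrow> nat \<Rightarrow> ennreal" where
  "influence_inf p \<F> i =
     emeasure (biased_measure_inf p) {S \<in> Pow {1..}. card (\<F> \<inter> {S, sym_diff S {i}}) = 1}"

text \<open>Extended values, since the series of influences may diverge for a general family.\<close>

definition total_influence_inf :: "real \<Rightarrow> nat set set \<Rightarrow> ennreal" where
  "total_influence_inf p \<F> = (\<Sum>i. influence_inf p \<F> (Suc i))"

subsection \<open>Lexicographic families\<close>

text \<open>\<open>B\<close> is the set of positions \<open>i\<^sub>1 < i\<^sub>2 < \<dots>\<close> of the digits 1.\<close>

definition is_binary_expansion :: "real \<Rightarrow> nat set \<Rightarrow> bool" where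
  "is_binary_expansion l B \<longleftrightarrow>
     B \<subseteq> {1..} \<and> ((\<lambda>i. 1 / 2 ^ i) has_sum l) B \<and>
     ((\<exists>(m::int) (k::nat). l = of_int m / 2 ^ k) \<longrightarrow> finite B)"

definition binary_expansion :: "real \<Rightarrow> nat set" where
  "binary_expansion l = (THE B. is_binary_expansion l B)"

definition lex_family :: "real \<Rightarrow> nat set set" where
  "lex_family l =
     (if l = 0 then {}
      else if l = 1 then Pow {1..}
      else \<Union>i\<in>binary_expansion l.
             {S. S \<subseteq> {1..} \<and> S \<inter> {1..i} = {1..i} - {k \<in> binary_expansion l. k < i}})"

subsection \<open>Well-definedness\<close>

text \<open>The map used in the definition of the measure is measurable.\<close>

lemma measurable_seq_to_set:
  "(\<lambda>\<omega>. {i\<in>{1..}. \<omega> i}) \<in> measurable (\<Pi>\<^sub>M i\<in>{1::nat..}. measure_pmf (bernoulli_pmf p))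
      (sigma (Pow {1..}) cylinder_families)"
proof (rule measurable_measure_of)
  show "cylinder_families \<subseteq> Pow (Pow {1..})"
    by (auto simp: cylinder_families_def)
  show "(\<lambda>\<omega>. {i\<in>{1..}. \<omega> i}) \<in> space (\<Pi>\<^sub>M i\<in>{1::nat..}. measure_pmf (bernoulli_pmf p)) \<rightarrow> Pow {1..}"
    by auto
next
  fix \<F> assume "\<F> \<in> cylinder_families"
  hence "\<exists>J. finite J \<and> (\<forall>S\<in>Pow {1..}. \<forall>T\<in>Pow {1..}. S \<inter> J = T \<inter> J \<longrightarrow> (S \<in> \<F> \<longleftrightarrow> T \<in> \<F>))"
    unfolding cylinder_families_def by (elim CollectE conjE)
  then obtain J where finJ: "finite J"
    and "\<forall>S\<in>Pow {1..}. \<forall>T\<in>Pow {1..}. S \<inter> J = T \<inter> J \<longrightarrow> (S \<in> \<F> \<longleftrightarrow> T \<in> \<F>)"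
    by (elim exE conjE)
  hence J: "S \<in> \<F> \<longleftrightarrow> T \<in> \<F>" if "S \<subseteq> {1..}" "T \<subseteq> {1..}" "S \<inter> J = T \<inter> J" for S T
    using that by (metis PowI)
  let ?M = "\<Pi>\<^sub>M i\<in>{1::nat..}. measure_pmf (bernoulli_pmf p)"
  define K where "K = J \<inter> {1..}"
  have K: "finite K" "K \<subseteq> {1..}" using finJ by (auto simp: K_def)
  have eq: "(\<lambda>\<omega>. {i\<in>{1..}. \<omega> i}) -` \<F> \<inter> space ?M
      = (\<Union>T\<in>Pow K \<inter> \<F>. {\<omega> \<in> space ?M. \<forall>i\<in>K. \<omega> i = (i \<in> T)})"
  proof (intro equalityI subsetI)
    fix \<omega> assume w: "\<omega> \<in> (\<lambda>\<omega>. {i\<in>{1..}. \<omega> i}) -` \<F> \<inter> space ?M"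
    let ?T = "{i\<in>{1..}. \<omega> i} \<inter> K"
    have "?T \<subseteq> {1..}" "{i\<in>{1..}. \<omega> i} \<subseteq> {1..}" "?T \<inter> J = {i\<in>{1..}. \<omega> i} \<inter> J"
      by (auto simp: K_def)
    from J[OF this] have "?T \<in> \<F>"
      using w by simp
    thus "\<omega> \<in> (\<Union>T\<in>Pow K \<inter> \<F>. {\<omega> \<in> space ?M. \<forall>i\<in>K. \<omega> i = (i \<in> T)})"
      using w K by (intro UN_I[of ?T]) auto
  next
    fix \<omega> assume "\<omega> \<in> (\<Union>T\<in>Pow K \<inter> \<F>. {\<omega> \<in> space ?M. \<forall>i\<in>K. \<omega> i = (i \<in> T)})"
    then obtain T where T: "T \<subseteq> K" "T \<in> \<F>" "\<omega> \<in> space ?M" "\<forall>i\<in>K. \<omega> i = (i \<in> T)"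
      by auto
    have "{i\<in>{1..}. \<omega> i} \<inter> J = T \<inter> J"
      using T K unfolding K_def by blast
    moreover have "{i\<in>{1..}. \<omega> i} \<subseteq> {1..}" "T \<subseteq> {1..}" using T K by auto
    ultimately have "{i\<in>{1..}. \<omega> i} \<in> \<F>"
      using J T(2) by metis
    thus "\<omega> \<in> (\<lambda>\<omega>. {i\<in>{1..}. \<omega> i}) -` \<F> \<inter> space ?M" using T by auto
  qed
  have "{\<omega> \<in> space ?M. \<forall>i\<in>K. \<omega> i = (i \<in> T)} \<in> sets ?M" for T
  proof (rule sets.sets_Collect_finite_All[OF _ K(1)])
    fix i assume "i \<in> K"
    hence [measurable]: "(\<lambda>\<omega>. \<omega> i) \<in> measurable ?M (count_space UNIV)"
      using K(2) measurable_component_singleton[of i "{1..}" "\<lambda>_. measure_pmf (bernoulli_pmf p)"]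
      by (auto cong: measurable_cong_sets)
    show "{\<omega> \<in> space ?M. \<omega> i = (i \<in> T)} \<in> sets ?M" by measurable
  qed
  thus "(\<lambda>\<omega>. {i\<in>{1..}. \<omega> i}) -` \<F> \<inter> space ?M \<in> sets ?M"
    unfolding eq using K(1) by (intro sets.finite_UN) auto
qed

lemma prob_space_biased_measure_inf: "prob_space (biased_measure_inf p)"
proof -
  have "prob_space (\<Pi>\<^sub>M i\<in>{1::nat..}. measure_pmf (bernoulli_pmf p))"
    by (rule prob_space_PiM) (rule prob_space_measure_pmf)
  thus ?thesis
    unfolding biased_measure_inf_def by (rule prob_space.prob_space_distr) (rule measurable_seq_to_set)
qed

lemma lex_family_measurable: "lex_family l \<in> sets (biased_measure_inf p)"
proof -
  have sets_eq: "sets (biased_measure_inf p) = sigma_sets (Pow {1..}) cylinder_families"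
    unfolding biased_measure_inf_def sets_distr
    by (rule sets_measure_of) (auto simp: cylinder_families_def)
  have space_eq: "space (biased_measure_inf p) = Pow {1..}"
    unfolding biased_measure_inf_def space_distr
    by (rule space_measure_of) (auto simp: cylinder_families_def)
  have "{S. S \<subseteq> {1..} \<and> S \<inter> {1..i} = X} \<in> cylinder_families" for i :: nat and X
    unfolding cylinder_families_def by (auto intro!: exI[of _ "{1..i}"])
  hence "{S. S \<subseteq> {1..} \<and> S \<inter> {1..i} = X} \<in> sets (biased_measure_inf p)" for i :: nat and X
    unfolding sets_eq by (rule sigma_sets.Basic)
  moreover have "Pow {1..} \<in> sets (biased_measure_inf p)"
    using sets.top[of "biased_measure_inf p"] unfolding space_eq .
  ultimately show ?thesis
    unfolding lex_family_def by (auto intro!: sets.countable_UN'')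
qed

lemma sum_digits:
  fixes l :: real
  assumes "0 \<le> l" "l < 1"
  shows "(\<Sum>i | i \<in> {1..n} \<and> odd \<lfloor>2 ^ i * l\<rfloor>. 1 / 2 ^ i) = (of_int \<lfloor>2 ^ n * l\<rfloor> / 2 ^ n :: real)"
proof (induction n)
  case 0
  have "\<lfloor>l\<rfloor> = 0" using assms by linarith
  thus ?case by simp
next
  case (Suc n)
  let ?D = "\<lambda>n. {i. i \<in> {1..n} \<and> odd \<lfloor>2 ^ i * l\<rfloor>}"
  have fl: "\<lfloor>2 ^ Suc n * l\<rfloor> = 2 * \<lfloor>2 ^ n * l\<rfloor> + (if odd \<lfloor>2 ^ Suc n * l\<rfloor> then 1 else 0)"
  proof -
    have "\<lfloor>2 ^ Suc n * l\<rfloor> = 2 * \<lfloor>2 ^ n * l\<rfloor> \<or> \<lfloor>2 ^ Suc n * l\<rfloor> = 2 * \<lfloor>2 ^ n * l\<rfloor> + 1"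
    proof -
      define y where "y = 2 ^ n * l"
      have "2 ^ Suc n * l = 2 * y" by (simp add: y_def)
      moreover have "\<lfloor>2 * y\<rfloor> = 2 * \<lfloor>y\<rfloor> \<or> \<lfloor>2 * y\<rfloor> = 2 * \<lfloor>y\<rfloor> + 1" by linarith
      ultimately show ?thesis by (simp only: y_def)
    qed
    thus ?thesis by (elim disjE) simp_all
  qed
  have D: "?D (Suc n) = (if odd \<lfloor>2 ^ Suc n * l\<rfloor> then insert (Suc n) (?D n) else ?D n)"
    by (auto simp: le_Suc_eq)
  have "(\<Sum>i\<in>?D (Suc n). 1 / 2 ^ i :: real)
      = (\<Sum>i\<in>?D n. 1 / 2 ^ i) + (if odd \<lfloor>2 ^ Suc n * l\<rfloor> then 1 / 2 ^ Suc n else 0)"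
    unfolding D by simp
  also have "\<dots> = of_int \<lfloor>2 ^ n * l\<rfloor> / 2 ^ n + (if odd \<lfloor>2 ^ Suc n * l\<rfloor> then 1 / 2 ^ Suc n else 0)"
    using Suc.IH by simp
  also have "\<dots> = of_int (2 * \<lfloor>2 ^ n * l\<rfloor> + (if odd \<lfloor>2 ^ Suc n * l\<rfloor> then 1 else 0)) / 2 ^ Suc n"
    by (simp add: field_simps)
  finally show ?case using fl by simp
qed

lemma is_binary_expansion_digits:
  assumes l: "0 \<le> l" "l < 1"
  shows "is_binary_expansion l {i\<in>{1..}. odd \<lfloor>2 ^ i * l\<rfloor>}"
proof -
  let ?D = "{i\<in>{1..}. odd \<lfloor>2 ^ i * l\<rfloor>}"
  let ?f = "\<lambda>i. if i \<in> ?D then 1 / 2 ^ i else 0 :: real"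
  have partial: "sum ?f {..<Suc n} = of_int \<lfloor>2 ^ n * l\<rfloor> / 2 ^ n" for n
  proof -
    have "sum ?f {..<Suc n} = (\<Sum>i | i \<in> {1..n} \<and> odd \<lfloor>2 ^ i * l\<rfloor>. 1 / 2 ^ i)"
      by (rule sum.mono_neutral_cong_right) auto
    thus ?thesis using sum_digits[OF l] by simp
  qed
  have "(\<lambda>n. sum ?f {..<Suc n}) \<longlonglongrightarrow> l"
  proof (rule tendsto_sandwich)
    show "(\<lambda>n. l - (1 / 2) ^ n) \<longlonglongrightarrow> l"
      by (rule tendsto_eq_intros LIMSEQ_realpow_zero | simp)+
    show "(\<lambda>n. l) \<longlonglongrightarrow> l" by simp
    have "l - (1 / 2) ^ n \<le> of_int \<lfloor>2 ^ n * l\<rfloor> / 2 ^ n" for n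
    proof -
      have "2 ^ n * l - 1 \<le> of_int \<lfloor>2 ^ n * l\<rfloor>" by linarith
      hence "(2 ^ n * l - 1) / 2 ^ n \<le> of_int \<lfloor>2 ^ n * l\<rfloor> / 2 ^ n" by (intro divide_right_mono) auto
      thus ?thesis by (simp add: diff_divide_distrib power_one_over)
    qed
    thus "\<forall>\<^sub>F n in sequentially. l - (1 / 2) ^ n \<le> sum ?f {..<Suc n}"
      unfolding partial by simp
    have "of_int \<lfloor>2 ^ n * l\<rfloor> / 2 ^ n \<le> l" for n
    proof -
      have "of_int \<lfloor>2 ^ n * l\<rfloor> \<le> 2 ^ n * l" by linarith
      thus ?thesis by (simp add: divide_le_eq mult.commute)
    qed
    thus "\<forall>\<^sub>F n in sequentially. sum ?f {..<Suc n} \<le> l"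
      unfolding partial by simp
  qed
  hence "?f sums l"
    unfolding sums_def by (subst (asm) filterlim_sequentially_Suc)
  hence "(?f has_sum l) UNIV"
    by (rule sums_nonneg_imp_has_sum) auto
  hence hs: "((\<lambda>i. 1 / 2 ^ i) has_sum l) ?D"
    by (subst has_sum_cong_neutral[where S = ?D and T = UNIV and g = ?f]) auto
  have "finite ?D" if "l = of_int m / 2 ^ k" for m :: int and k :: nat
  proof (rule finite_subset)
    show "?D \<subseteq> {..k}"
    proof
      fix i assume i: "i \<in> ?D"
      show "i \<in> {..k}"
      proof (rule ccontr)
        assume "i \<notin> {..k}"
        hence ki: "i = k + Suc (i - Suc k)" by simp
        define j where "j = i - Suc k"
        have "2 ^ i * l = of_int (2 * 2 ^ j * m)"
          unfolding that by (subst ki, simp add: j_def power_add)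
        hence "\<lfloor>2 ^ i * l\<rfloor> = 2 * 2 ^ j * m" by (metis floor_of_int)
        thus False using i by simp
      qed
    qed
  qed simp
  thus ?thesis using hs unfolding is_binary_expansion_def by blast
qed

lemma has_sum_half_tail: "((\<lambda>i. 1 / 2 ^ i :: real) has_sum (1 / 2 ^ m)) {m<..}"
proof -
  have "(\<lambda>n. 1 / 2 ^ Suc m * (1 / 2) ^ n :: real) sums (1 / 2 ^ Suc m * (1 / (1 - 1 / 2)))"
    by (intro sums_mult geometric_sums) simp
  hence "(\<lambda>n. 1 / 2 ^ (n + Suc m) :: real) sums (1 / 2 ^ m)"
    by (simp add: power_add power_one_over mult_ac)
  hence "((\<lambda>n. 1 / 2 ^ (n + Suc m) :: real) has_sum (1 / 2 ^ m)) UNIV"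
    by (rule sums_nonneg_imp_has_sum) simp
  moreover have "bij_betw (\<lambda>n. n + Suc m) UNIV {m<..}"
    by (rule bij_betwI[of _ _ _ "\<lambda>n. n - Suc m"]) auto
  ultimately show ?thesis
    using has_sum_reindex_bij_betw[of "\<lambda>n. n + Suc m" UNIV "{m<..}" "\<lambda>i. 1 / 2 ^ i :: real"] by simp
qed

lemma is_binary_expansion_not_less:
  assumes B: "is_binary_expansion l B" and C: "is_binary_expansion l C"
    and m: "m \<in> B" "m \<notin> C" and agree: "\<And>i. i < m \<Longrightarrow> i \<in> B \<longleftrightarrow> i \<in> C"
  shows False
proof -
  let ?f = "\<lambda>i. 1 / 2 ^ i :: real"
  define P where "P = B \<inter> {..<m}"
  have P: "finite P" "P \<subseteq> B" "P \<subseteq> {..m}" "m \<notin> P" "P \<inter> {m<..} = {}" by (auto simp: P_def)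
  have CP: "C \<subseteq> P \<union> {m<..}"
  proof
    fix i assume "i \<in> C"
    thus "i \<in> P \<union> {m<..}" using m agree[of i] by (cases i m rule: linorder_cases) (auto simp: P_def)
  qed
  have sB: "(?f has_sum l) B" and sC: "(?f has_sum l) C"
    using B C by (auto simp: is_binary_expansion_def)
  have "(?f has_sum (sum ?f (insert m P))) (insert m P)" using P by (intro has_sum_finite) simp
  hence ge: "sum ?f (insert m P) \<le> l"
    by (rule has_sum_mono2[OF _ sB]) (use P m in auto)
  have PT: "(?f has_sum (sum ?f P + 1 / 2 ^ m)) (P \<union> {m<..})"
    using P by (intro has_sum_Un_disjoint has_sum_half_tail has_sum_finite) auto
  have le: "l \<le> sum ?f P + 1 / 2 ^ m"
    by (rule has_sum_mono2[OF sC PT CP]) simp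
  have l: "l = sum ?f (insert m P)" using ge le P by simp
  have "sum ?f (insert m P) = (\<Sum>i\<in>insert m P. of_int (2 ^ (m - i)) / 2 ^ m)"
    by (intro sum.cong) (use P in \<open>auto simp: field_simps simp flip: power_add\<close>)
  also have "\<dots> = of_int (\<Sum>i\<in>insert m P. 2 ^ (m - i)) / 2 ^ m"
    by (simp only: of_int_sum sum_divide_distrib)
  finally have "finite C" using C l unfolding is_binary_expansion_def by blast
  then obtain k where k: "k > m" "k \<notin> C"
    using infinite_Ioi[of m] by (meson finite_subset greaterThan_iff subsetI)
  have "(?f has_sum (l + ?f k)) (C \<union> {k})"
    using k by (intro has_sum_Un_disjoint sC has_sum_finiteI) auto
  hence "l + ?f k \<le> sum ?f P + 1 / 2 ^ m"
    by (rule has_sum_mono2[OF _ PT]) (use k CP in auto)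
  moreover have "?f k > 0" by simp
  moreover have "l = sum ?f P + 1 / 2 ^ m" using l P by simp
  ultimately show False by linarith
qed

lemma ex1_binary_expansion:
  assumes "0 \<le> l" "l < 1"
  shows "\<exists>!B. is_binary_expansion l B"
proof (rule ex_ex1I)
  show "\<exists>B. is_binary_expansion l B" using is_binary_expansion_digits[OF assms] by blast
next
  fix B C assume BC: "is_binary_expansion l B" "is_binary_expansion l C"
  show "B = C"
  proof (rule ccontr)
    assume "B \<noteq> C"
    define m where "m = (LEAST i. i \<in> B \<longleftrightarrow> i \<notin> C)"
    have "\<exists>i. i \<in> B \<longleftrightarrow> i \<notin> C" using \<open>B \<noteq> C\<close> by blast
    hence m: "m \<in> B \<longleftrightarrow> m \<notin> C" unfolding m_def by (rule LeastI_ex)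
    have agree: "i \<in> B \<longleftrightarrow> i \<in> C" if "i < m" for i
      using not_less_Least[of i] that unfolding m_def by blast
    show False
      using is_binary_expansion_not_less[OF BC, of m] is_binary_expansion_not_less[OF BC(2,1), of m]
        m agree by blast
  qed
qed

end

theory Submission
  imports Defs
begin

text \<open>
  Let \<open>x\<^sub>N\<close> be the conditional measure of the lexicographic family given that the first \<open>N\<close>
  coordinates leave membership undecided, and \<open>q\<^sub>N\<close> the probability of that event. Then
  \<open>x\<^sub>N\<close> is \<open>p + (1 - p) x\<^sub>N\<^sub>+\<^sub>1\<close> or \<open>p x\<^sub>N\<^sub>+\<^sub>1\<close>, according to the digit \<open>N + 1\<close>, and the influence of
  coordinate \<open>N + 1\<close> is \<open>q\<^sub>N (1 - x\<^sub>N\<^sub>+\<^sub>1)\<close> or \<open>q\<^sub>N x\<^sub>N\<^sub>+\<^sub>1\<close>. With \<open>\<phi> x = x log\<^sub>p x\<close>, each influence times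
  \<open>p\<close> is at least \<open>q\<^sub>N \<phi> x\<^sub>N - q\<^sub>N\<^sub>+\<^sub>1 \<phi> x\<^sub>N\<^sub>+\<^sub>1\<close>, so telescoping gives the biased edge-isoperimetric
  inequality: \<open>p\<close> times the total influence is at least \<open>\<phi> (1 - p)\<close>, which exceeds \<open>p\<close> when \<open>p > 1/2\<close>.
  For \<open>p < 1/2\<close> the same argument applies to the dual family.
\<close>

section \<open>The function \<open>x log_a x\<close>\<close>

text \<open>The base is a parameter because it is taken to be whichever of \<open>p\<close> and
  \<open>1 - p\<close> exceeds 1/2. The value at \<open>x = 0\<close> is 0, the continuous
  extension.\<close>

definition plogp :: "real \<Rightarrow> real \<Rightarrow> real" where
  "plogp a x = x * ln x / ln a"

lemma ln_less_minus_one: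
  fixes u :: real
  assumes "0 < u" "u \<noteq> 1"
  shows "ln u < u - 1"
  using ln_le_minus_one[of u] ln_eq_minus_one[of u] assms by fastforce

text \<open>The step inequality at a digit 1. Multiplied by \<open>ln a < 0\<close>, it becomes a
  lower bound for \<open>w * ln w\<close>, obtained as a Gibbs-type inequality.\<close>

lemma plogp_le_convex:
  assumes a: "0 < a" "a < 1" and x: "0 \<le> x" "x \<le> 1"
  shows "plogp a (a + (1 - a) * x) \<le> a * (1 - x) + (1 - a) * plogp a x"
proof (cases "x = 0")
  case True
  then show ?thesis using a by (simp add: plogp_def)
next
  case False
  with x have x0: "0 < x" by simp
  define w where "w = a + (1 - a) * x"
  have w: "0 < w" using a x0 by (auto simp: w_def intro!: add_pos_nonneg)
  have ln_le: "c * ln (v / w) \<le> c * (v / w - 1)" if "0 \<le> c" "0 < v" for c v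
    using that w ln_le_minus_one[of "v / w"] by (intro mult_left_mono) auto
  \<comment> \<open>The weights \<open>a (1 - x)\<close>, \<open>(1 - a) x\<close>, \<open>a x\<close> add up to \<open>w\<close>; apply \<open>ln u \<le> u - 1\<close> to each term.\<close>
  have "a * (1 - x) * ln (a / w) + (1 - a) * x * ln (x / w) + a * x * ln (1 / w)
      \<le> a * (1 - x) * (a / w - 1) + (1 - a) * x * (x / w - 1) + a * x * (1 / w - 1)"
    using a x x0 by (intro add_mono ln_le) auto
  also have "\<dots> = - (a * x * (1 - a) * (1 - x)) / w"
    using w by (simp add: field_simps) (simp add: w_def algebra_simps power2_eq_square)
  also have "\<dots> \<le> 0" using a x w by simp
  finally have "a * (1 - x) * (ln a - ln w) + (1 - a) * x * (ln x - ln w) - a * x * ln w \<le> 0"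
    using a x0 w by (simp add: ln_div)
  moreover have "a * (1 - x) * (ln a - ln w) + (1 - a) * x * (ln x - ln w) - a * x * ln w
      = a * (1 - x) * ln a + (1 - a) * (x * ln x) - w * ln w"
    by (simp add: w_def algebra_simps)
  ultimately have "a * (1 - x) * ln a + (1 - a) * (x * ln x) \<le> w * ln w" by simp
  moreover have "ln a < 0" using a by simp
  ultimately have "w * ln w / ln a \<le> (a * (1 - x) * ln a + (1 - a) * (x * ln x)) / ln a"
    by (intro divide_right_mono_neg) auto
  also have "\<dots> = a * (1 - x) + (1 - a) * (x * ln x / ln a)"
    using \<open>ln a < 0\<close> by (simp add: add_divide_distrib)
  finally show ?thesis by (simp add: plogp_def w_def)
qed

text \<open>The counterpart at a digit 0 is the law of logarithms, hence an equality: such digits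
  lose nothing in the telescoping.\<close>

lemma plogp_mult:
  assumes "0 < a" "a < 1" "0 \<le> x"
  shows "plogp a (a * x) = a * x + a * plogp a x"
proof (cases "x = 0")
  case False
  moreover have "ln a \<noteq> 0" using assms by simp
  ultimately show ?thesis using assms by (simp add: plogp_def ln_mult field_simps)
qed (simp add: plogp_def)

text \<open>A bound uniform in \<open>x\<close>, from \<open>ln u \<le> u - 1\<close> at
  \<open>u = 1 / x\<close>; it controls the remainder of the telescoping sum.\<close>

lemma plogp_le:
  assumes "0 < a" "a < 1" "0 \<le> x"
  shows "plogp a x \<le> - 1 / ln a"
proof (cases "x = 0")
  case False
  have "x * ln (1 / x) \<le> x * (1 / x - 1)"
    using False assms by (intro mult_left_mono ln_le_minus_one) auto
  hence "- (x * ln x) \<le> 1" using False assms by (simp add: ln_div right_diff_distrib)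
  hence "-1 \<le> x * ln x" by simp
  moreover have "ln a < 0" using assms by simp
  ultimately show ?thesis unfolding plogp_def by (intro divide_right_mono_neg) auto
next
  case True
  have "ln a < 0" using assms by simp
  then show ?thesis by (simp add: plogp_def True divide_nonpos_neg)
qed

text \<open>Since \<open>plogp a a = a\<close>, this compares \<open>plogp a\<close> at
  \<open>1 - a\<close> and at \<open>a\<close>. The two agree when \<open>a = 1 / 2\<close>; the
  strictness of the theorem comes from here.\<close>

lemma plogp_complement_gt:
  assumes "1 / 2 < a" "a < 1"
  shows "a < plogp a (1 - a)"
proof -
  define t where "t = (1 - a) / a"
  have t: "0 < t" "t < 1" "t * a = 1 - a" using assms by (auto simp: t_def)
  \<comment> \<open>Strict concavity of \<open>ln\<close> at \<open>a = (1 - t) + t (1 - a)\<close>.\<close>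
  have "(1 - t) * ln (1 / a) + t * ln ((1 - a) / a) < (1 - t) * (1 / a - 1) + t * ((1 - a) / a - 1)"
    using t assms by (intro add_strict_mono mult_strict_left_mono ln_less_minus_one) (auto simp: field_simps)
  also have "\<dots> = 0" using assms t by (simp add: t_def field_simps)
  finally have "t * ln (1 - a) < ln a" using assms by (simp add: ln_div algebra_simps)
  hence "a * (t * ln (1 - a)) < a * ln a" using assms by simp
  hence "(1 - a) * ln (1 - a) < a * ln a" using t by (metis mult.assoc mult.commute)
  moreover have "ln a < 0" using assms by simp
  ultimately show ?thesis by (simp add: plogp_def neg_less_divide_eq)
qed

section \<open>Telescoping along the binary digits\<close>

text \<open>The potential \<open>q i * plogp a (x i)\<close> drops by at most \<open>a * I i\<close>
  in each step. Abstract sequences let one proof serve a family and its dual.\<close>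

lemma telescoped_bound:
  fixes x q I :: "nat \<Rightarrow> real" and d :: "nat \<Rightarrow> bool"
  assumes a: "0 < a" "a < 1"
    and x: "\<And>i. 0 \<le> x i" "\<And>i. x i \<le> 1"
    and q: "\<And>i. 0 \<le> q i" "q 0 = 1"
    and d1: "\<And>i. d i \<Longrightarrow> x i = a + (1 - a) * x (Suc i) \<and> q (Suc i) = (1 - a) * q i \<and> I i = q i * (1 - x (Suc i))"
    and d0: "\<And>i. \<not> d i \<Longrightarrow> x i = a * x (Suc i) \<and> q (Suc i) = a * q i \<and> I i = q i * x (Suc i)"
  shows "plogp a (x 0) - q N * plogp a (x N) \<le> a * (\<Sum>i<N. I i)"
proof (induction N)
  case 0
  then show ?case using q by simp
next
  case (Suc N)
  have "q N * plogp a (x N) - q (Suc N) * plogp a (x (Suc N)) \<le> a * I N"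
  proof (cases "d N")
    case True
    have "q N * plogp a (x N) \<le> q N * (a * (1 - x (Suc N)) + (1 - a) * plogp a (x (Suc N)))"
      using d1[OF True] plogp_le_convex[OF a x(1) x(2), of "Suc N"] q by (intro mult_left_mono) auto
    moreover have qI: "q (Suc N) = (1 - a) * q N" "I N = q N * (1 - x (Suc N))"
      using d1[OF True] by auto
    ultimately show ?thesis unfolding qI by (simp add: algebra_simps)
  next
    case False
    have "plogp a (x N) = a * x (Suc N) + a * plogp a (x (Suc N))"
      using d0[OF False] plogp_mult[OF a x(1)] by simp
    hence "q N * plogp a (x N) = q N * (a * x (Suc N) + a * plogp a (x (Suc N)))" by simp
    then show ?thesis using d0[OF False] by (simp add: algebra_simps)
  qed
  with Suc.IH show ?case by (simp add: distrib_left)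
qed

text \<open>The initial potential \<open>plogp a (1 - a)\<close> exceeds \<open>a\<close> by a fixed
  gap, while the remainder decays geometrically. Concluding with a partial sum avoids questions of
  convergence.\<close>

lemma sum_gt_1_if_digit_recursion:
  fixes x q I :: "nat \<Rightarrow> real" and d :: "nat \<Rightarrow> bool"
  assumes a: "1 / 2 < a" "a < 1"
    and x: "\<And>i. 0 \<le> x i" "\<And>i. x i \<le> 1" "x 0 = 1 - a"
    and q: "\<And>i. 0 \<le> q i" "q 0 = 1"
    and d1: "\<And>i. d i \<Longrightarrow> x i = a + (1 - a) * x (Suc i) \<and> q (Suc i) = (1 - a) * q i \<and> I i = q i * (1 - x (Suc i))"
    and d0: "\<And>i. \<not> d i \<Longrightarrow> x i = a * x (Suc i) \<and> q (Suc i) = a * q i \<and> I i = q i * x (Suc i)"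
  shows "\<exists>N. 1 < (\<Sum>i<N. I i)"
proof -
  have a0: "0 < a" "a < 1" using a by auto
  \<comment> \<open>As \<open>a > 1 / 2\<close>, both possible factors \<open>a\<close> and
    \<open>1 - a\<close> are at most \<open>a\<close>.\<close>
  have q_le: "q N \<le> a ^ N" for N
  proof (induction N)
    case (Suc N)
    have "q (Suc N) \<le> a * q N"
      using d0[of N] d1[of N] q(1)[of N] a by (cases "d N") (auto intro: mult_right_mono)
    also have "\<dots> \<le> a * a ^ N" using Suc a by (intro mult_left_mono) auto
    finally show ?case by simp
  qed (use q in simp)
  have "(\<lambda>N. a ^ N * (- 1 / ln a)) \<longlonglongrightarrow> 0 * (- 1 / ln a)"
    using a by (intro tendsto_mult LIMSEQ_realpow_zero tendsto_const) auto
  moreover have "0 < plogp a (1 - a) - a" using plogp_complement_gt[OF a] by simp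
  ultimately have "\<forall>\<^sub>F N in sequentially. a ^ N * (- 1 / ln a) < plogp a (1 - a) - a"
    by (intro order_tendstoD(2)) auto
  then obtain N where N: "a ^ N * (- 1 / ln a) < plogp a (1 - a) - a"
    by (auto simp: eventually_sequentially)
  have "q N * plogp a (x N) \<le> q N * (- 1 / ln a)"
    using plogp_le[OF a0 x(1)] q by (intro mult_left_mono) auto
  also have "\<dots> \<le> a ^ N * (- 1 / ln a)"
    using q_le a by (intro mult_right_mono) (auto simp: divide_nonpos_neg)
  finally have "a < plogp a (x 0) - q N * plogp a (x N)" using N x(3) by simp
  also have "\<dots> \<le> a * (\<Sum>i<N. I i)"
    using a0 x q d1 d0 by (intro telescoped_bound[where d = d]) auto
  finally show ?thesis using a0 by auto
qed

section \<open>The finite biased measure and the family of sets avoiding 1\<close>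

lemma sum_Pow_biased:
  fixes p :: real
  assumes "finite X"
  shows "(\<Sum>S\<in>Pow X. p ^ card S * (1 - p) ^ (card X - card S)) = 1"
proof -
  have "(\<Sum>S\<in>Pow X. p ^ card S * (1 - p) ^ (card X - card S))
      = (\<Sum>S\<in>Pow X. (\<Prod>i\<in>S. p) * (\<Prod>i\<in>X - S. 1 - p))"
    using assms by (intro sum.cong refl) (auto simp: card_Diff_subset finite_subset)
  also have "\<dots> = (\<Prod>i\<in>X. p + (1 - p))"
    using assms by (rule prod_add[symmetric])
  finally show ?thesis by simp
qed

lemma measure_biased_measure:
  assumes "0 \<le> p" "p \<le> 1" "\<F> \<subseteq> Pow {1..n}"
  shows "measure (biased_measure p n) \<F> = (\<Sum>S\<in>\<F>. p ^ card S * (1 - p) ^ (n - card S))"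
  unfolding biased_measure_def measure_def
  using assms by (subst emeasure_point_measure_finite) (auto simp: sum_ennreal sum_nonneg)

lemma measure_biased_measure_Pow:
  assumes "0 \<le> p" "p \<le> 1"
  shows "measure (biased_measure p n) (Pow {1..n}) = 1"
  using sum_Pow_biased[of "{1..n}" p] by (simp add: measure_biased_measure[OF assms])

text \<open>Coordinate 1 contributes the factor \<open>1 - p\<close>, and the biased weights on
  subsets of \<open>{2..n}\<close> sum to 1.\<close>

lemma measure_biased_measure_dictator:
  assumes "0 \<le> p" "p \<le> 1" "n \<ge> 1"
  shows "measure (biased_measure p n) {S. S \<subseteq> {1..n} \<and> 1 \<notin> S} = 1 - p"
proof -
  have eq: "{S. S \<subseteq> {1..n} \<and> 1 \<notin> S} = Pow {2..n}"
    by (auto simp: subset_iff) (metis le_antisym not_less_eq_eq numeral_2_eq_2)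
  have "measure (biased_measure p n) {S. S \<subseteq> {1..n} \<and> 1 \<notin> S}
      = (\<Sum>S\<in>Pow {2..n}. p ^ card S * (1 - p) ^ (n - card S))"
    using assms by (subst measure_biased_measure) (auto simp flip: eq)
  also have "\<dots> = (\<Sum>S\<in>Pow {2..n}. (1 - p) * (p ^ card S * (1 - p) ^ (card {2..n} - card S)))"
  proof (rule sum.cong[OF refl])
    fix S assume "S \<in> Pow {2..n}"
    hence "card S \<le> n - 1" using card_mono[of "{2..n}" S] by simp
    hence "n - card S = Suc (n - 1 - card S)" using assms by simp
    then show "p ^ card S * (1 - p) ^ (n - card S)
        = (1 - p) * (p ^ card S * (1 - p) ^ (card {2..n} - card S))" by simp
  qed
  also have "\<dots> = 1 - p" by (simp only: sum_Pow_biased finite_atLeastAtMost mult_1_right flip: sum_distrib_left)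
  finally show ?thesis .
qed

lemma card_inter_toggle_eq_1_iff:
  "card (\<F> \<inter> {S, sym_diff S {i}}) = 1 \<longleftrightarrow> (S \<in> \<F>) \<noteq> (sym_diff S {i} \<in> \<F>)"
proof -
  have "S \<noteq> sym_diff S {i}" by blast
  then show ?thesis by (cases "S \<in> \<F>"; cases "sym_diff S {i} \<in> \<F>") auto
qed

text \<open>Toggling 1 always changes membership, and toggling any other element never does.\<close>

lemma total_influence_dictator:
  assumes "0 \<le> p" "p \<le> 1" "n \<ge> 1"
  shows "total_influence p n {S. S \<subseteq> {1..n} \<and> 1 \<notin> S} = 1"
proof -
  let ?A = "{S. S \<subseteq> {1..n} \<and> 1 \<notin> S}"
  have "influence p n ?A i = (if i = 1 then 1 else 0)" if "i \<in> {1..n}" for i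
  proof -
    have "{S \<in> Pow {1..n}. card (?A \<inter> {S, sym_diff S {i}}) = 1}
        = {S \<in> Pow {1..n}. (S \<in> ?A) \<noteq> (sym_diff S {i} \<in> ?A)}"
      by (simp only: card_inter_toggle_eq_1_iff)
    also have "\<dots> = (if i = 1 then Pow {1..n} else {})"
      using that assms by (auto split: if_splits)
    finally show ?thesis
      unfolding influence_def using measure_biased_measure_Pow[OF assms(1,2)] by simp
  qed
  hence "total_influence p n ?A = (\<Sum>i=1..n. if i = 1 then 1 else 0)"
    unfolding total_influence_def by (intro sum.cong) auto
  then show ?thesis using assms by simp
qed

section \<open>Independence of one coordinate in the infinite product\<close>

lemma sets_biased_measure_inf:
  "sets (biased_measure_inf p) = sigma_sets (Pow {1..}) cylinder_families"
  unfolding biased_measure_inf_def sets_distr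
  by (rule sets_measure_of) (auto simp: cylinder_families_def)

lemma space_biased_measure_inf: "space (biased_measure_inf p) = Pow {1..}"
  unfolding biased_measure_inf_def space_distr
  by (rule space_measure_of) (auto simp: cylinder_families_def)

lemma cylinder_families_sets: "\<F> \<in> cylinder_families \<Longrightarrow> \<F> \<in> sets (biased_measure_inf p)"
  unfolding sets_biased_measure_inf by (rule sigma_sets.Basic)

text \<open>Forcing a coordinate rather than toggling it gives a function of the other coordinates
  alone.\<close>

definition set_coord :: "'a \<Rightarrow> bool \<Rightarrow> 'a set \<Rightarrow> 'a set" where
  "set_coord i b S = (if b then insert i S else S - {i})"

lemma set_coord_subset: "i \<in> X \<Longrightarrow> S \<subseteq> X \<Longrightarrow> set_coord i b S \<subseteq> X"
  by (auto simp: set_coord_def)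

text \<open>It suffices to check generators: the preimage of a family depending on \<open>J\<close>
  again depends only on \<open>J\<close>.\<close>

lemma set_coord_measurable:
  assumes "i \<ge> 1"
  shows "set_coord i b \<in> measurable (biased_measure_inf p) (biased_measure_inf p)"
proof (rule measurable_sigma_sets[OF sets_biased_measure_inf])
  show "cylinder_families \<subseteq> Pow (Pow {1..})" by (auto simp: cylinder_families_def)
  show "set_coord i b \<in> space (biased_measure_inf p) \<rightarrow> Pow {1..}"
    using assms set_coord_subset[of i "{1..}"] by (simp add: space_biased_measure_inf)
  fix \<F> assume "\<F> \<in> cylinder_families"
  then obtain J where J: "finite J"
    "\<forall>S\<in>Pow {1..}. \<forall>T\<in>Pow {1..}. S \<inter> J = T \<inter> J \<longrightarrow> (S \<in> \<F> \<longleftrightarrow> T \<in> \<F>)"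
    unfolding cylinder_families_def by (elim CollectE conjE exE) (rule that)
  have key: "set_coord i b S \<in> \<F> \<longleftrightarrow> set_coord i b T \<in> \<F>"
    if "S \<in> Pow {1..}" "T \<in> Pow {1..}" "S \<inter> J = T \<inter> J" for S T
  proof (intro J(2)[rule_format] PowI set_coord_subset)
    show "set_coord i b S \<inter> J = set_coord i b T \<inter> J"
      using that(3) unfolding set_coord_def by auto
  qed (use that assms in auto)
  have "set_coord i b -` \<F> \<inter> Pow {1..} \<in> cylinder_families"
    unfolding cylinder_families_def
  proof (intro CollectI conjI exI[of _ J] ballI impI)
    fix S T assume ST: "S \<in> Pow {1::nat..}" "T \<in> Pow {1::nat..}" "S \<inter> J = T \<inter> J"
    show "S \<in> set_coord i b -` \<F> \<inter> Pow {1..} \<longleftrightarrow> T \<in> set_coord i b -` \<F> \<inter> Pow {1..}"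
      using key[OF ST] ST(1,2) by blast
  qed (use J(1) in auto)
  then show "set_coord i b -` \<F> \<inter> space (biased_measure_inf p) \<in> sets (biased_measure_inf p)"
    unfolding space_biased_measure_inf by (rule cylinder_families_sets)
qed

text \<open>Where \<open>i \<in> S\<close> has truth value \<open>b\<close>, forcing
  \<open>i\<close> to \<open>b\<close> changes nothing. So \<open>\<F>\<close> agrees there with the
  forced event, which is independent of coordinate \<open>i\<close>.\<close>

lemma measure_coord_eq:
  assumes i: "i \<ge> 1" and G: "\<F> \<in> sets (biased_measure_inf p)"
  shows "measure (biased_measure_inf p) {S\<in>\<F>. (i \<in> S) = b}
    = pmf (bernoulli_pmf p) b * measure (biased_measure_inf p) {S\<in>Pow {1..}. set_coord i b S \<in> \<F>}"
proof -
  let ?M = "biased_measure_inf p" and ?\<beta> = "measure_pmf (bernoulli_pmf p)"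
  let ?P = "\<Pi>\<^sub>M i\<in>{1::nat..}. ?\<beta>" and ?Q = "\<Pi>\<^sub>M i\<in>{1::nat..} - {i}. ?\<beta>"
  define X :: "(nat \<Rightarrow> bool) \<Rightarrow> nat set" where "X = (\<lambda>\<omega>. {i\<in>{1..}. \<omega> i})"
  have G_sub: "\<F> \<subseteq> Pow {1..}"
    using sets.sets_into_space[OF G] by (simp add: space_biased_measure_inf)
  interpret Q: prob_space ?Q by (intro prob_space_PiM prob_space_measure_pmf)
  have X: "X \<in> measurable ?P ?M"
    using measurable_seq_to_set[of p] unfolding biased_measure_inf_def X_def
    by (simp cong: measurable_cong_sets)
  have ins: "insert i ({1..} - {i}) = {1..}" using i by auto
  \<comment> \<open>The product measure is the law of an independent bit \<open>x\<close> inserted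
    at \<open>i\<close> into a sequence \<open>Y\<close> on the remaining coordinates.\<close>
  have split: "distr (?\<beta> \<Otimes>\<^sub>M ?Q) ?P (\<lambda>(x, Y). Y(i := x)) = ?P"
    using distr_pair_PiM_eq_PiM[of "{1..} - {i}" "\<lambda>_. ?\<beta>" i]
    by (simp only: ins prob_space_measure_pmf)
  have upd: "(\<lambda>(x, Y). Y(i := x)) \<in> measurable (?\<beta> \<Otimes>\<^sub>M ?Q) ?P"
    using ins unfolding case_prod_beta
    by (intro measurable_fun_upd[of _ "{1..} - {i}"] measurable_fst measurable_snd) auto
  have em: "emeasure ?M H = emeasure (?\<beta> \<Otimes>\<^sub>M ?Q) {(x, Y). Y \<in> space ?Q \<and> X (Y(i := x)) \<in> H}"
    if H: "H \<in> sets ?M" for H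
  proof -
    have "emeasure ?M H = emeasure (distr ?P ?M X) H"
      unfolding biased_measure_inf_def X_def by (intro arg_cong2[where f = emeasure] distr_cong) auto
    also have "\<dots> = emeasure (distr (?\<beta> \<Otimes>\<^sub>M ?Q) ?P (\<lambda>(x, Y). Y(i := x))) (X -` H \<inter> space ?P)"
      unfolding split using X H by (rule emeasure_distr)
    also have "\<dots> = emeasure (?\<beta> \<Otimes>\<^sub>M ?Q) ((\<lambda>(x, Y). Y(i := x)) -` (X -` H \<inter> space ?P) \<inter> space (?\<beta> \<Otimes>\<^sub>M ?Q))"
      using upd measurable_sets[OF X H] by (rule emeasure_distr)
    also have "(\<lambda>(x, Y). Y(i := x)) -` (X -` H \<inter> space ?P) \<inter> space (?\<beta> \<Otimes>\<^sub>M ?Q)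
      = {(x, Y). Y \<in> space ?Q \<and> X (Y(i := x)) \<in> H}"
      using measurable_space[OF upd] by (auto simp: space_pair_measure simp del: fun_upd_apply)
    finally show ?thesis .
  qed
  \<comment> \<open>The section of \<open>\<F>\<close> at \<open>x = b\<close>; the two events to
    compare become the rectangles \<open>{b} \<times> R\<close> and
    \<open>UNIV \<times> R\<close>.\<close>
  define R where "R = {Y \<in> space ?Q. X (Y(i := b)) \<in> \<F>}"
  have R: "R \<in> sets ?Q"
  proof -
    have "(\<lambda>Y. Y(i := b)) \<in> measurable ?Q ?P"
      using measurable_compose[OF measurable_Pair1'[of b ?\<beta> ?Q] upd] by simp
    from measurable_sets[OF measurable_compose[OF this X] G]
    show ?thesis unfolding R_def by (simp add: vimage_def Int_def conj_commute)
  qed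
  have 1: "{S\<in>\<F>. (i \<in> S) = b} \<in> sets ?M"
  proof -
    have "{S\<in>Pow {1..}. (i \<in> S) = b} \<in> cylinder_families"
      unfolding cylinder_families_def by (auto intro!: exI[of _ "{i}"])
    hence "\<F> \<inter> {S\<in>Pow {1..}. (i \<in> S) = b} \<in> sets ?M"
      by (intro sets.Int[OF G] cylinder_families_sets)
    also have "\<F> \<inter> {S\<in>Pow {1..}. (i \<in> S) = b} = {S\<in>\<F>. (i \<in> S) = b}"
      using G_sub by auto
    finally show ?thesis .
  qed
  have 2: "{S\<in>Pow {1..}. set_coord i b S \<in> \<F>} \<in> sets ?M"
    using measurable_sets[OF set_coord_measurable[OF i] G]
    by (simp add: vimage_def Int_def space_biased_measure_inf conj_commute)
  have X_upd: "i \<in> X (Y(i := x)) \<longleftrightarrow> x" "set_coord i b (X (Y(i := x))) = X (Y(i := b))" for Y x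
    using i by (auto simp: set_coord_def X_def)
  have "emeasure ?M {S\<in>\<F>. (i \<in> S) = b} = emeasure (?\<beta> \<Otimes>\<^sub>M ?Q) ({b} \<times> R)"
    unfolding em[OF 1] by (rule arg_cong[where f = "emeasure _"]) (auto simp: X_upd R_def simp del: fun_upd_apply)
  also have "\<dots> = ennreal (pmf (bernoulli_pmf p) b) * emeasure ?Q R"
    using R by (subst Q.emeasure_pair_measure_Times) (simp_all only: emeasure_pmf_single sets_measure_pmf UNIV_I)
  finally have e1: "emeasure ?M {S\<in>\<F>. (i \<in> S) = b} = ennreal (pmf (bernoulli_pmf p) b) * emeasure ?Q R" .
  have "X \<omega> \<subseteq> {1..}" for \<omega> by (auto simp: X_def)
  hence "emeasure ?M {S\<in>Pow {1..}. set_coord i b S \<in> \<F>} = emeasure (?\<beta> \<Otimes>\<^sub>M ?Q) (UNIV \<times> R)"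
    unfolding em[OF 2] by (intro arg_cong[where f = "emeasure _"]) (auto simp: X_upd R_def simp del: fun_upd_apply)
  also have "\<dots> = emeasure ?Q R"
    using R measure_pmf.emeasure_space_1[of "bernoulli_pmf p"]
    by (subst Q.emeasure_pair_measure_Times) simp_all
  finally show ?thesis using e1 by (simp only: measure_def enn2real_mult enn2real_ennreal pmf_nonneg)
qed

section \<open>Lexicographic families by first disagreement\<close>

text \<open>These are the sets strictly above the threshold \<open>{1..} - B\<close> in the
  lexicographic order; the first difference from the threshold lies in both \<open>S\<close> and
  \<open>B\<close>.\<close>

definition lex_up :: "nat set \<Rightarrow> nat set set" where
  "lex_up B = {S. S \<subseteq> {1..} \<and> (\<exists>i\<in>B. i \<in> S \<and> (\<forall>k\<in>{1..<i}. k \<in> S \<longleftrightarrow> k \<notin> B))}"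

text \<open>Agreement with the threshold up to \<open>N\<close>; outside this event the first
  \<open>N\<close> coordinates decide membership in \<open>lex_up B\<close>.\<close>

definition critical_prefix :: "nat set \<Rightarrow> nat \<Rightarrow> nat set set" where
  "critical_prefix B N = {S. S \<subseteq> {1..} \<and> (\<forall>k\<in>{1..N}. k \<in> S \<longleftrightarrow> k \<notin> B)}"

text \<open>Splitting \<open>{1..i}\<close> into \<open>i\<close> and \<open>{1..<i}\<close> turns
  the prescribed prefix into agreement with the threshold before \<open>i\<close> and departure from
  it at \<open>i\<close>.\<close>

lemma lex_family_eq_lex_up:
  assumes "0 < l" "l < 1"
  shows "lex_family l = lex_up (binary_expansion l)"
proof -
  let ?B = "binary_expansion l"
  have "is_binary_expansion l ?B"
    unfolding binary_expansion_def by (rule theI'[OF ex1_binary_expansion]) (use assms in auto)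
  hence B: "?B \<subseteq> {1..}" by (simp add: is_binary_expansion_def)
  have "S \<inter> {1..i} = {1..i} - {k \<in> ?B. k < i}
      \<longleftrightarrow> i \<in> S \<and> (\<forall>k\<in>{1..<i}. k \<in> S \<longleftrightarrow> k \<notin> ?B)" if "i \<in> ?B" for S i
  proof -
    have "i \<ge> 1" using that B by auto
    hence "{1..i} = insert i {1..<i}" by auto
    then show ?thesis by auto
  qed
  then show ?thesis using assms unfolding lex_family_def lex_up_def by auto
qed


lemma critical_prefix_sets: "critical_prefix B N \<in> sets (biased_measure_inf p)"
proof (rule cylinder_families_sets)
  show "critical_prefix B N \<in> cylinder_families"
    unfolding cylinder_families_def critical_prefix_def
    by (intro CollectI conjI exI[of _ "{1..N}"]) (auto simp: set_eq_iff)
qed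

text \<open>Only \<open>k\<close> can be a witness: an earlier one contradicts the agreement before
  \<open>k\<close>, and a later one would need agreement with the threshold at
  \<open>k\<close>.\<close>

lemma lex_up_iff_first_disagreement:
  assumes "S \<subseteq> {1..}" "1 \<le> k" "k \<in> S \<longleftrightarrow> k \<in> B" "\<And>j. 1 \<le> j \<Longrightarrow> j < k \<Longrightarrow> j \<in> S \<longleftrightarrow> j \<notin> B"
  shows "S \<in> lex_up B \<longleftrightarrow> k \<in> B"
proof
  assume "S \<in> lex_up B"
  then obtain i where i: "i \<in> B" "i \<in> S" "\<forall>j\<in>{1..<i}. j \<in> S \<longleftrightarrow> j \<notin> B"
    by (auto simp: lex_up_def)
  have "1 \<le> i" using i assms(1) by auto
  show "k \<in> B"
  proof (cases i k rule: linorder_cases)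
    case less
    then show ?thesis using assms(4)[of i] i \<open>1 \<le> i\<close> by blast
  next
    case greater
    then show ?thesis using bspec[OF i(3), of k] assms(2,3) by auto
  qed (use i in simp)
next
  assume "k \<in> B"
  hence "k \<in> S" using assms(3) by simp
  then show "S \<in> lex_up B"
    unfolding lex_up_def using \<open>k \<in> B\<close> assms(1,4) by (intro CollectI conjI bexI[of _ k]) auto
qed

text \<open>The first departure of \<open>S\<close> from the threshold happens within the first
  \<open>N\<close> coordinates, so \<open>T\<close> shares it.\<close>

lemma lex_up_cong_outside_prefix:
  assumes "S \<subseteq> {1..}" "T \<subseteq> {1..}" "S \<inter> {1..N} = T \<inter> {1..N}" "S \<notin> critical_prefix B N"
  shows "S \<in> lex_up B \<longleftrightarrow> T \<in> lex_up B"
proof -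
  let ?D = "\<lambda>k. k \<in> {1..N} \<and> (k \<in> S \<longleftrightarrow> k \<in> B)"
  define k where "k = (LEAST k. ?D k)"
  have "\<exists>k. ?D k" using assms by (auto simp: critical_prefix_def)
  hence k: "?D k" unfolding k_def by (rule LeastI_ex)
  have agree: "j \<in> S \<longleftrightarrow> j \<notin> B" if "1 \<le> j" "j < k" for j
    using not_less_Least[of j ?D] that k unfolding k_def[symmetric] by auto
  have ST: "j \<in> S \<longleftrightarrow> j \<in> T" if "1 \<le> j" "j \<le> k" for j
  proof -
    have "j \<in> S \<inter> {1..N} \<longleftrightarrow> j \<in> T \<inter> {1..N}" using assms(3) by simp
    then show ?thesis using that k by auto
  qed
  have "S \<in> lex_up B \<longleftrightarrow> k \<in> B"
    by (rule lex_up_iff_first_disagreement) (use assms(1) k agree in simp_all)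
  moreover have "T \<in> lex_up B \<longleftrightarrow> k \<in> B"
    by (rule lex_up_iff_first_disagreement) (use assms(2) k agree ST[OF _ less_imp_le] ST[of k] in auto)
  ultimately show ?thesis by simp
qed

lemma critical_prefix_Suc:
  "critical_prefix B (Suc N) = {S \<in> critical_prefix B N. (Suc N \<in> S) = (Suc N \<notin> B)}"
  by (auto simp: critical_prefix_def atLeastAtMostSuc_conv)

lemma set_coord_in_critical_prefix_iff:
  "S \<subseteq> {1..} \<Longrightarrow> set_coord (Suc N) b S \<in> critical_prefix B N \<longleftrightarrow> S \<in> critical_prefix B N"
  by (auto simp: critical_prefix_def set_coord_def)

text \<open>Giving \<open>Suc N\<close> the same status in the set as in \<open>B\<close> makes it
  the first departure.\<close>

lemma set_coord_Suc_in_lex_up: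
  assumes "S \<in> critical_prefix B N"
  shows "set_coord (Suc N) (Suc N \<in> B) S \<in> lex_up B \<longleftrightarrow> Suc N \<in> B"
proof (rule lex_up_iff_first_disagreement)
  show "set_coord (Suc N) (Suc N \<in> B) S \<subseteq> {1..}"
    using assms by (auto simp: critical_prefix_def set_coord_def)
  show "j \<in> set_coord (Suc N) (Suc N \<in> B) S \<longleftrightarrow> j \<notin> B" if "1 \<le> j" "j < Suc N" for j
    using that assms by (auto simp: critical_prefix_def set_coord_def)
qed (auto simp: set_coord_def)

text \<open>Within the critical prefix, one of the two sets leaves the threshold at
  \<open>Suc N\<close> and is decided, while the other stays on it. The coordinate is pivotal when
  the latter has the opposite membership.\<close>

lemma pivotal_lex_up_iff:
  assumes S: "S \<subseteq> {1..}"
  shows "(S \<in> lex_up B) \<noteq> (sym_diff S {Suc N} \<in> lex_up B) \<longleftrightarrow>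
    S \<in> critical_prefix B N \<and>
    (set_coord (Suc N) (Suc N \<notin> B) S \<in> lex_up B \<longleftrightarrow> Suc N \<notin> B)"
proof (cases "S \<in> critical_prefix B N")
  case True
  have "(S = set_coord (Suc N) (Suc N \<in> B) S \<and>
         sym_diff S {Suc N} = set_coord (Suc N) (Suc N \<notin> B) S) \<or>
        (S = set_coord (Suc N) (Suc N \<notin> B) S \<and>
         sym_diff S {Suc N} = set_coord (Suc N) (Suc N \<in> B) S)"
    by (auto simp: set_coord_def)
  with set_coord_Suc_in_lex_up[OF True] True show ?thesis by metis
next
  case False
  have "S \<in> lex_up B \<longleftrightarrow> sym_diff S {Suc N} \<in> lex_up B"
    by (rule lex_up_cong_outside_prefix[OF S _ _ False]) (use S in auto)
  with False show ?thesis by simp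
qed

section \<open>Recursion over the digits and the lower bound\<close>

lemma lex_up_recursion:
  fixes p :: real and B :: "nat set"
  assumes p: "0 < p" "p < 1" and L: "lex_up B \<in> sets (biased_measure_inf p)"
  defines "u \<equiv> \<lambda>N. measure (biased_measure_inf p) (lex_up B \<inter> critical_prefix B N)"
    and "q \<equiv> \<lambda>N. measure (biased_measure_inf p) (critical_prefix B N)"
    and "I \<equiv> \<lambda>N. measure (biased_measure_inf p) {S \<in> Pow {1..}. card (lex_up B \<inter> {S, sym_diff S {Suc N}}) = 1}"
  shows "Suc N \<in> B \<Longrightarrow> q (Suc N) = (1 - p) * q N \<and> u N = p * q N + u (Suc N) \<and>
            I N = q N - u (Suc N) / (1 - p)"
    and "Suc N \<notin> B \<Longrightarrow> q (Suc N) = p * q N \<and> u N = u (Suc N) \<and> I N = u (Suc N) / p"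
proof -
  let ?M = "biased_measure_inf p" and ?C = "critical_prefix B"
  let ?i = "Suc N"
  interpret prob_space ?M by (rule prob_space_biased_measure_inf)
  note C = critical_prefix_sets[of B _ p]
  have C_sub: "S \<in> ?C N \<Longrightarrow> S \<subseteq> {1..}" for S N by (auto simp: critical_prefix_def)
  have pmf: "pmf (bernoulli_pmf p) b = (if b then p else 1 - p)" for b
    using p by (cases b) auto
  have C_half: "prob {S \<in> ?C N. (?i \<in> S) = b} = (if b then p else 1 - p) * q N" for b
  proof -
    have "{S \<in> Pow {1..}. set_coord ?i b S \<in> ?C N} = ?C N"
      using C_sub set_coord_in_critical_prefix_iff by blast
    then show ?thesis
      using measure_coord_eq[OF _ C, of ?i N b] unfolding q_def by (simp add: pmf)
  qed
  let ?b = "?i \<notin> B"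
  \<comment> \<open>The sets of the critical prefix that join the family once \<open>Suc N\<close>
    is forced to stay on the threshold. By independence its probability is \<open>u (Suc N)\<close>
    over the probability of that branch, and the influence is expressed through it.\<close>
  let ?T = "{S \<in> Pow {1..}. set_coord ?i ?b S \<in> lex_up B \<inter> ?C ?i}"
  have T_eq: "?T = {S \<in> ?C N. set_coord ?i ?b S \<in> lex_up B}"
    using C_sub set_coord_in_critical_prefix_iff[of _ N ?b B]
    unfolding critical_prefix_Suc by (auto simp: set_coord_def)
  have "{S \<in> lex_up B \<inter> ?C ?i. (?i \<in> S) = ?b} = lex_up B \<inter> ?C ?i"
    by (auto simp: critical_prefix_Suc)
  hence u_Suc: "u ?i = (if ?b then p else 1 - p) * prob ?T"
    using measure_coord_eq[OF _ sets.Int[OF L C], of ?i ?i ?b] unfolding u_def by (simp add: pmf)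
  have T_sets: "?T \<in> events"
    using measurable_sets[OF set_coord_measurable sets.Int[OF L C], of ?i ?b ?i]
    by (simp add: vimage_def Int_def space_biased_measure_inf conj_commute)
  have pivotal: "{S \<in> Pow {1..}. card (lex_up B \<inter> {S, sym_diff S {?i}}) = 1}
      = {S \<in> ?C N. set_coord ?i ?b S \<in> lex_up B \<longleftrightarrow> ?b}"
    unfolding card_inter_toggle_eq_1_iff using C_sub pivotal_lex_up_iff[of _ B N] by blast
  {
    assume B: "?i \<in> B"
    have "q ?i = (1 - p) * q N"
      using C_half[of False] B unfolding critical_prefix_Suc q_def by simp
    moreover have "u N = p * q N + u ?i"
    proof -
      \<comment> \<open>At a digit 1, containing \<open>Suc N\<close> settles membership
        positively.\<close>
      have in_L: "S \<in> lex_up B" if "S \<in> ?C N" "?i \<in> S" for S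
        using set_coord_Suc_in_lex_up[OF that(1)] that(2) B
        by (simp add: set_coord_def insert_absorb)
      have "lex_up B \<inter> ?C N = {S \<in> ?C N. ?i \<in> S} \<union> (lex_up B \<inter> ?C ?i)"
        using in_L B by (auto simp: critical_prefix_Suc)
      moreover have "prob ({S \<in> ?C N. ?i \<in> S} \<union> (lex_up B \<inter> ?C ?i))
          = prob {S \<in> ?C N. ?i \<in> S} + prob (lex_up B \<inter> ?C ?i)"
      proof (rule finite_measure_Union)
        have "{S \<in> ?C N. ?i \<in> S} = ?C N - ?C ?i" using B by (auto simp: critical_prefix_Suc)
        then show "{S \<in> ?C N. ?i \<in> S} \<in> events" using C by auto
        show "lex_up B \<inter> ?C ?i \<in> events" using L C by auto
        show "{S \<in> ?C N. ?i \<in> S} \<inter> (lex_up B \<inter> ?C ?i) = {}"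
          using B by (auto simp: critical_prefix_Suc)
      qed
      ultimately show ?thesis using C_half[of True] unfolding u_def by simp
    qed
    moreover have "I N = q N - prob ?T"
    proof -
      have "{S \<in> ?C N. set_coord ?i ?b S \<in> lex_up B \<longleftrightarrow> ?b} = ?C N - ?T"
        unfolding T_eq using B by auto
      moreover have "prob (?C N - ?T) = q N - prob ?T"
        unfolding q_def using T_sets C T_eq by (intro finite_measure_Diff) auto
      ultimately show ?thesis unfolding I_def pivotal by simp
    qed
    ultimately show "q ?i = (1 - p) * q N \<and> u N = p * q N + u ?i \<and> I N = q N - u ?i / (1 - p)"
      using u_Suc B p by simp
  }
  {
    assume B: "?i \<notin> B"
    have "q ?i = p * q N"
      using C_half[of True] B unfolding critical_prefix_Suc q_def by simp
    moreover have "u N = u ?i"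
    proof -
      \<comment> \<open>At a digit 0, omitting \<open>Suc N\<close> settles membership
        negatively.\<close>
      have "S \<notin> lex_up B" if "S \<in> ?C N" "?i \<notin> S" for S
        using set_coord_Suc_in_lex_up[OF that(1)] that(2) B by (simp add: set_coord_def)
      hence "lex_up B \<inter> ?C N = lex_up B \<inter> ?C ?i"
        using B by (auto simp: critical_prefix_Suc)
      then show ?thesis by (simp add: u_def)
    qed
    moreover have "I N = prob ?T"
      unfolding I_def pivotal T_eq using B by simp
    ultimately show "q ?i = p * q N \<and> u N = u ?i \<and> I N = u ?i / p"
      using u_Suc B p by simp
  }
qed

text \<open>Whether \<open>p\<close> or \<open>1 - p\<close> exceeds 1/2 decides if the digit
  recursion is applied to the family or to its dual.\<close>

lemma total_influence_lex_up_gt_1: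
  fixes p :: real
  assumes p: "0 < p" "p < 1" "p \<noteq> 1 / 2" and L: "lex_up B \<in> sets (biased_measure_inf p)"
    and m: "measure (biased_measure_inf p) (lex_up B) = 1 - p"
  shows "1 < total_influence_inf p (lex_up B)"
proof -
  interpret prob_space "biased_measure_inf p" by (rule prob_space_biased_measure_inf)
  define u where "u N = prob (lex_up B \<inter> critical_prefix B N)" for N
  define q where "q N = prob (critical_prefix B N)" for N
  define I where "I N = prob {S \<in> Pow {1..}. card (lex_up B \<inter> {S, sym_diff S {Suc N}}) = 1}" for N
  note rec = lex_up_recursion[OF p(1,2) L, folded u_def q_def I_def]
  have C0: "critical_prefix B 0 = Pow {1..}" by (auto simp: critical_prefix_def)
  have "q 0 = 1"
    using prob_space unfolding q_def C0 space_biased_measure_inf .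
  have "lex_up B \<inter> Pow {1..} = lex_up B" by (auto simp: lex_up_def)
  hence "u 0 = 1 - p" using m by (simp only: u_def C0)
  have q_pos: "0 < q N" for N
  proof (induction N)
    case (Suc N)
    then show ?case using rec[of N] p by (cases "Suc N \<in> B") auto
  qed (use \<open>q 0 = 1\<close> in simp)
  \<comment> \<open>The conditional measure given the critical prefix, meaningful because
    \<open>q N > 0\<close>.\<close>
  define x where "x N = u N / q N" for N
  have u_le: "u N \<le> q N" for N
    unfolding u_def q_def by (intro finite_measure_mono critical_prefix_sets) auto
  have x01: "0 \<le> x N" "x N \<le> 1" for N
    using q_pos[of N] u_le[of N] by (auto simp: x_def u_def)
  have x0: "x 0 = 1 - p" using \<open>q 0 = 1\<close> \<open>u 0 = 1 - p\<close> by (simp add: x_def)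
  have rec1: "x N = p + (1 - p) * x (Suc N) \<and> q (Suc N) = (1 - p) * q N \<and> I N = q N * (1 - x (Suc N))"
    if "Suc N \<in> B" for N
  proof -
    \<comment> \<open>Naming \<open>1 - p\<close> keeps \<open>field_simps\<close> from distributing
      over it.\<close>
    define r where "r = 1 - p"
    have "r > 0" using p by (simp add: r_def)
    moreover have eqs: "q (Suc N) = r * q N" "u N = p * q N + u (Suc N)" "I N = q N - u (Suc N) / r"
      using rec(1)[OF that] by (auto simp: r_def)
    ultimately show ?thesis
      using q_pos[of N] unfolding x_def r_def[symmetric] eqs by (simp add: field_simps)
  qed
  have rec0: "x N = p * x (Suc N) \<and> q (Suc N) = p * q N \<and> I N = q N * x (Suc N)"
    if "Suc N \<notin> B" for N
    using rec(2)[OF that] q_pos[of N] p by (simp add: x_def field_simps)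
  have "\<exists>N. 1 < (\<Sum>i<N. I i)"
  proof (cases "p > 1 / 2")
    case True
    show ?thesis
      by (rule sum_gt_1_if_digit_recursion[of p x q "\<lambda>i. Suc i \<in> B"])
        (use True p x01 x0 \<open>q 0 = 1\<close> q_pos rec1 rec0 in \<open>auto simp: less_imp_le\<close>)
  next
    case False
    \<comment> \<open>Complementing sets turns \<open>lex_up B\<close> into the family with the opposite digits and \<open>p\<close>
      into \<open>1 - p\<close>, and it preserves influences.\<close>
    show ?thesis
    proof (rule sum_gt_1_if_digit_recursion[of "1 - p" "\<lambda>i. 1 - x i" q "\<lambda>i. Suc i \<notin> B"])
      show "1 - x i = 1 - p + (1 - (1 - p)) * (1 - x (Suc i)) \<and>
          q (Suc i) = (1 - (1 - p)) * q i \<and> I i = q i * (1 - (1 - x (Suc i)))"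
        if "Suc i \<notin> B" for i
        using rec0[OF that] by (simp add: algebra_simps)
      show "1 - x i = (1 - p) * (1 - x (Suc i)) \<and>
          q (Suc i) = (1 - p) * q i \<and> I i = q i * (1 - x (Suc i))"
        if "\<not> Suc i \<notin> B" for i
        using rec1[of i] that by (simp add: algebra_simps)
    qed (use False p x01 x0 \<open>q 0 = 1\<close> q_pos in \<open>auto simp: less_imp_le\<close>)
  qed
  then obtain N where "1 < (\<Sum>i<N. I i)" ..
  hence "1 < ennreal (\<Sum>i<N. I i)" by simp
  also have "\<dots> = (\<Sum>i<N. influence_inf p (lex_up B) (Suc i))"
    by (simp add: influence_inf_def emeasure_eq_measure I_def sum_ennreal)
  also have "\<dots> \<le> total_influence_inf p (lex_up B)"
    unfolding total_influence_inf_def by (rule sum_le_suminf) auto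
  finally show ?thesis .
qed

theorem mainTheorem4:
  fixes p l :: real and n :: nat and A :: "nat set set"
  assumes "0 < p" and "p < 1" and "p \<noteq> 1 / 2"
    and "n \<ge> 1"
    and "A = {S. S \<subseteq> {1..n} \<and> 1 \<notin> S}"
    and "0 \<le> l" and "l \<le> 1"
    and "measure (biased_measure_inf p) (lex_family l) = 1 - p"
  shows "measure (biased_measure p n) A = 1 - p \<and>
    total_influence p n A = 1 \<and> 1 < total_influence_inf p (lex_family l)"
proof (intro conjI)
  show "measure (biased_measure p n) A = 1 - p"
    unfolding assms(5) using assms(1,2,4) by (intro measure_biased_measure_dictator) auto
  show "total_influence p n A = 1"
    unfolding assms(5) using assms(1,2,4) by (intro total_influence_dictator) auto
  \<comment> \<open>The families for \<open>l = 0\<close> and \<open>l = 1\<close> have measures 0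
    and 1, neither of which is \<open>1 - p\<close>.\<close>
  have "l \<noteq> 0" using assms(2,8) by (auto simp: lex_family_def)
  moreover have "l \<noteq> 1"
  proof
    assume "l = 1"
    hence "lex_family l = space (biased_measure_inf p)"
      by (simp add: lex_family_def space_biased_measure_inf)
    then show False
      using assms(1,8) prob_space.prob_space[OF prob_space_biased_measure_inf, of p] by simp
  qed
  ultimately have eq: "lex_family l = lex_up (binary_expansion l)"
    using assms(6,7) by (intro lex_family_eq_lex_up) auto
  show "1 < total_influence_inf p (lex_family l)"
    using total_influence_lex_up_gt_1[OF assms(1-3)] lex_family_measurable[of l p] assms(8)
    unfolding eq by blast
qed

end
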